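(* Let $P$ be a pack for $PS$ with $|M_P \setminus M_0| \geq 2$, and let $s := \sum_{ij \in P} a_{ij}$. For any $i^*j^* \in P$ with $i^* \notin M_0$ and $j^* = n_{i^*}$, the inequality $$\sum_{i \in M_P \setminus\{ i^*\}} \sum_{j \in N_i} a_{ij} x_{ij} + \sum_{ij \in P,\; i \in (M_P \setminus M_0) \setminus\{ i^*\}} (b-s) x_{ij} + a_{i^* j^*} x_{i^* j^*} + \sum_{j \in N_{i^*} \setminus\{ j^*\}} a_{i^* j^*} \max\left\{1, \frac{a_{i^* j} }{ a_{i^* j^*} + b - s} \right\} x_{i^* j} \leq b + (|M_P \setminus M_0| - 2) (b-s)$$ is valid for $PS$. Furthermore, when $P$ is a maximal switching pack, this inequality is facet-defining for $PS$.
   Context: Let $M=\{1,\dots,m\}$, $N_i=\{1,\dots,n_i\}$ for $i\in M$, $I=\{(i,j)\mid i\in M, j\in N_i\}$ (the pair $(i,j)$ is also written $ij$), $d=\sum_{i\in M} n_i$, and let $b\in\mathbb{R}_+$, $a_{ij}\in\mathbb{R}_+$ for $ij\in I$. Let $S$ be the set of $x\in[0,1]^d$ (with coordinates $x_{ij}$, $ij\in I$) satisfying $\sum_{i\in M}\sum_{j\in N_i}a_{ij}x_{ij}\le b$ and $x_{ij}\cdot x_{ij'}=0$ for all $i\in M$, $j\ne j'\in N_i$. The complementarity knapsack polytope is $PS=\operatorname{conv}(S)$. Let $M_0=\{i\in M\mid n_i=1\}$. Standing assumptions: $M\ne M_0$; $\sum_{i\in M}\max\{a_{i1},\dots,a_{in_i}\}>b$;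 $b>0$ and $a_{ij}\ge 0$ for all $ij\in I$; $a_{i1}\ge\dots\ge a_{in_i}$ for all $i\in M\setminus M_0$. For $T\subseteq I$, $M_T=\{i\in M\mid ij\in T\text{ for some } j\in N_i\}$. A pack is a set $P=\{i_1j_1,\dots,i_kj_k\}\subset I$ with $i_1,\dots,i_k$ all distinct and $\sum_{ij\in P}a_{ij}<b$. A pack $P$ is a maximal switching pack if $j=n_i$ for every $ij\in P$, and $\sum_{ij\in P}a_{ij}-a_{i'n_{i'}}+a_{i',n_{i'}-1}>b$ for every $i'\in M_P\setminus M_0$.
   Formalization: The facet claim is false if zero weights are allowed without restriction; it is proved under the added (necessary) condition that a_{i*j*} > 0, or |M_P \ M_0| = 2, or some ij in P with i in M_0 has a_ij > 0. Validity is unchanged. *)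

theory Defs
  imports "HOL-Analysis.Analysis"
begin

(* The pairs (i,j) index the coordinates of R^d through a bijection
   pos from index_set m n onto the finite index type 'k, so that x_ij is
   x $ pos (i, j) and real ^ 'k is R^d with d = n 1 + ... + n m. *)

definition index_set :: "nat \<Rightarrow> (nat \<Rightarrow> nat) \<Rightarrow> (nat \<times> nat) set" where
  "index_set m n = (SIGMA i:{1..m}. {1..n i})"

definition singleton_blocks :: "nat \<Rightarrow> (nat \<Rightarrow> nat) \<Rightarrow> nat set" where
  "singleton_blocks m n = {i \<in> {1..m}. n i = 1}"

definition feasible_set ::
  "nat \<Rightarrow> (nat \<Rightarrow> nat) \<Rightarrow> (nat \<Rightarrow> nat \<Rightarrow> real) \<Rightarrow> real \<Rightarrow> (nat \<times> nat \<Rightarrow> 'k::finite) \<Rightarrow> (real ^ 'k) set"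
where
  "feasible_set m n a b pos =
     {x. (\<forall>k. 0 \<le> x $ k \<and> x $ k \<le> 1) \<and>
         (\<Sum>i\<in>{1..m}. \<Sum>j\<in>{1..n i}. a i j * x $ pos (i, j)) \<le> b \<and>
         (\<forall>i\<in>{1..m}. \<forall>j\<in>{1..n i}. \<forall>j'\<in>{1..n i}.
            j \<noteq> j' \<longrightarrow> x $ pos (i, j) * x $ pos (i, j') = 0)}"

definition ck_polytope ::
  "nat \<Rightarrow> (nat \<Rightarrow> nat) \<Rightarrow> (nat \<Rightarrow> nat \<Rightarrow> real) \<Rightarrow> real \<Rightarrow> (nat \<times> nat \<Rightarrow> 'k::finite) \<Rightarrow> (real ^ 'k) set"
where
  "ck_polytope m n a b pos = convex hull (feasible_set m n a b pos)"

definition touched_blocks :: "nat \<Rightarrow> (nat \<Rightarrow> nat) \<Rightarrow> (nat \<times> nat) set \<Rightarrow> nat set" where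
  "touched_blocks m n T = {i \<in> {1..m}. \<exists>j\<in>{1..n i}. (i, j) \<in> T}"

definition weight :: "(nat \<Rightarrow> nat \<Rightarrow> real) \<Rightarrow> (nat \<times> nat) set \<Rightarrow> real" where
  "weight a P = (\<Sum>(i, j)\<in>P. a i j)"

definition pack ::
  "nat \<Rightarrow> (nat \<Rightarrow> nat) \<Rightarrow> (nat \<Rightarrow> nat \<Rightarrow> real) \<Rightarrow> real \<Rightarrow> (nat \<times> nat) set \<Rightarrow> bool"
where
  "pack m n a b P \<longleftrightarrow> P \<subseteq> index_set m n \<and> inj_on fst P \<and> weight a P < b"

definition maximal_switching_pack ::
  "nat \<Rightarrow> (nat \<Rightarrow> nat) \<Rightarrow> (nat \<Rightarrow> nat \<Rightarrow> real) \<Rightarrow> real \<Rightarrow> (nat \<times> nat) set \<Rightarrow> bool"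
where
  "maximal_switching_pack m n a b P \<longleftrightarrow>
     pack m n a b P \<and>
     (\<forall>(i, j)\<in>P. j = n i) \<and>
     (\<forall>i\<in>touched_blocks m n P - singleton_blocks m n.
        weight a P - a i (n i) + a i (n i - 1) > b)"

definition valid_inequality ::
  "(real ^ 'k \<Rightarrow> real) \<Rightarrow> real \<Rightarrow> (real ^ 'k::finite) set \<Rightarrow> bool"
where
  "valid_inequality f \<beta> C \<longleftrightarrow> (\<forall>x\<in>C. f x \<le> \<beta>)"

definition facet_defining ::
  "(real ^ 'k \<Rightarrow> real) \<Rightarrow> real \<Rightarrow> (real ^ 'k::finite) set \<Rightarrow> bool"
where
  "facet_defining f \<beta> C \<longleftrightarrow> valid_inequality f \<beta> C \<and> {x \<in> C. f x = \<beta>} facet_of C"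

(* The nondegeneracy condition needed for the facet property.  It cannot be
   dropped: for m = 3, n i = 2, b = 1, a i 1 = 2, a i 2 = 0 and
   P = {(1,2),(2,2),(3,2)}, i0 = 3, the inequality is the sum of the two valid
   inequalities 2 x_11 + x_12 <= 1 and 2 x_21 + x_22 <= 1. *)
definition nondegenerate_lifting ::
  "nat \<Rightarrow> (nat \<Rightarrow> nat) \<Rightarrow> (nat \<Rightarrow> nat \<Rightarrow> real) \<Rightarrow> (nat \<times> nat) set \<Rightarrow> nat \<Rightarrow> nat \<Rightarrow> bool"
where
  "nondegenerate_lifting m n a P i0 j0 \<longleftrightarrow>
     a i0 j0 > 0 \<or>
     card (touched_blocks m n P - singleton_blocks m n) = 2 \<or>
     (\<exists>(i, j)\<in>P. i \<in> singleton_blocks m n \<and> a i j > 0)"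

end

theory Submission
  imports Defs
begin

text \<open>
  A feasible point picks one index \<open>J i\<close> per block and a value \<open>y i\<close> there, so both claims are about
  sums \<open>\<Sum>i. h i (J i) * y i\<close>. Write \<open>\<delta> = b - s\<close>.

  Validity: if some block of \<open>M\<^sub>P - M\<^sub>0\<close> other than \<open>i0\<close> leaves the pack, the \<open>\<delta>\<close>-terms contribute at
  most \<open>|M\<^sub>P - M\<^sub>0| - 2\<close> times \<open>\<delta>\<close> and the knapsack constraint bounds the rest by \<open>b\<close>. Otherwise they
  contribute at most \<open>|M\<^sub>P - M\<^sub>0| - 1\<close> times \<open>\<delta>\<close>, and the rest is at most \<open>s\<close> by the choice of the
  coefficients in block \<open>i0\<close>.

  Facet: the polytope is full-dimensional, so it suffices that every linear functional that is constant
  on the tight points is a multiple \<open>\<mu>\<close> of the left-hand side. Perturbing the pack outside \<open>M\<^sub>P\<close> and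
  switching one block to another index fixes the functional up to one factor \<open>\<mu> i\<close> per block; moving
  weight from \<open>i0\<close> or from a singleton block to a switched block \<open>i\<close> shows that these factors agree.
  Nondegeneracy says that such weight exists, or that there is only one factor to consider.
\<close>

section \<open>A facet criterion for full-dimensional convex sets\<close>

text \<open>The differences \<open>x - z\<close> of points of the face span the whole hyperplane
  orthogonal to \<open>c\<close>. Otherwise some nonzero vector orthogonal to \<open>c\<close> would
  be orthogonal to all of them and so give a functional that is constant on the face; by
  \<open>multiple\<close> it would be parallel to \<open>c\<close>, a contradiction.\<close>

lemma facet_of_hyperplaneI:
  fixes c :: "'a::euclidean_space"
  assumes "convex C" "aff_dim C = DIM('a)" "c \<noteq> 0"
    and le: "\<And>x. x \<in> C \<Longrightarrow> c \<bullet> x \<le> \<beta>"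
    and z: "z \<in> C" "c \<bullet> z = \<beta>"
    and multiple: "\<And>g. (\<And>x. x \<in> C \<Longrightarrow> c \<bullet> x = \<beta> \<Longrightarrow> g \<bullet> x = g \<bullet> z) \<Longrightarrow> \<exists>\<mu>. g = \<mu> *\<^sub>R c"
  shows "{x \<in> C. c \<bullet> x = \<beta>} facet_of C"
proof -
  define F where "F = {x \<in> C. c \<bullet> x = \<beta>}"
  have F: "F = C \<inter> {x. c \<bullet> x = \<beta>}" and zF: "z \<in> F"
    using z by (auto simp: F_def)
  have face: "F face_of C"
    unfolding F using assms(1) le by (rule face_of_Int_supporting_hyperplane_le)
  define V where "V = span ((\<lambda>x. x - z) ` F)"
  have "{v. c \<bullet> v = 0} \<subseteq> V"
  proof
    fix v assume "v \<in> {v. c \<bullet> v = 0}"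
    then have v: "c \<bullet> v = 0" by simp
    \<comment> \<open>The part \<open>w\<close> of \<open>v\<close> orthogonal to \<open>V\<close>
      is the functional to which \<open>multiple\<close> applies; the aim is
      \<open>w = 0\<close>.\<close>
    obtain y w where y: "y \<in> V" and w: "\<And>u. u \<in> V \<Longrightarrow> orthogonal w u" and vyw: "v = y + w"
      using orthogonal_subspace_decomp_exists[of "(\<lambda>x. x - z) ` F" v] unfolding V_def by metis
    have "w \<bullet> x = w \<bullet> z" if "x \<in> C" "c \<bullet> x = \<beta>" for x
    proof -
      have "x - z \<in> V"
        unfolding V_def using that by (intro span_base) (auto simp: F_def)
      then show ?thesis
        using w by (fastforce simp: orthogonal_def inner_diff_right)
    qed
    then obtain \<mu> where "w = \<mu> *\<^sub>R c"
      using multiple by blast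
    then have "w \<bullet> v = 0" using v by simp
    moreover have "w \<bullet> y = 0" using w[OF y] by (simp add: orthogonal_def)
    ultimately have "w \<bullet> w = 0" using vyw by (simp add: inner_add_right)
    then show "v \<in> V" using y vyw by simp
  qed
  \<comment> \<open>The dimension of the face is squeezed: \<open>dim V\<close> bounds it from
    below, the hyperplane that contains it from above.\<close>
  then have "dim {v. c \<bullet> v = 0} \<le> dim V" by (rule dim_subset)
  moreover have "dim V = aff_dim F"
    unfolding V_def dim_span using aff_dim_eq_dim[of z F] zF by (simp add: hull_inc algebra_simps image_def)
  moreover have "aff_dim F \<le> aff_dim {x. c \<bullet> x = \<beta>}"
    using F by (intro aff_dim_subset) auto
  ultimately have "aff_dim F = aff_dim C - 1"
    using assms(2,3) dim_hyperplane[of c] aff_dim_hyperplane[of c \<beta>] DIM_positive[where 'a='a]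
    by (simp add: of_nat_diff)
  then show ?thesis
    using face zF unfolding facet_of_def F_def by blast
qed

section \<open>Feasible points as selections of one index per block\<close>

text \<open>The weights \<open>h\<close> are a parameter, so that knapsack weight, left-hand side
  and arbitrary linear functionals are all evaluated by the same rules.\<close>

definition selection_sum ::
  "nat \<Rightarrow> (nat \<Rightarrow> nat \<Rightarrow> real) \<Rightarrow> (nat \<Rightarrow> nat) \<Rightarrow> (nat \<Rightarrow> real) \<Rightarrow> real"
where
  "selection_sum m h J y = (\<Sum>i\<in>{1..m}. h i (J i) * y i)"

text \<open>All tight points used below differ from one base point in at most two blocks; this rule
  yields the change of every linear functional at once.\<close>

lemma selection_sum_upd:
  assumes "i \<in> {1..m}"
  shows "selection_sum m h (J(i := j)) (y(i := t)) =
    selection_sum m h J y - h i (J i) * y i + h i j * t"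
proof -
  have "(\<Sum>l\<in>{1..m} - {i}. h l ((J(i := j)) l) * (y(i := t)) l) = (\<Sum>l\<in>{1..m} - {i}. h l (J l) * y l)"
    by (intro sum.cong) auto
  then show ?thesis
    using sum.remove[OF _ assms, of "\<lambda>l. h l ((J(i := j)) l) * (y(i := t)) l"]
      sum.remove[OF _ assms, of "\<lambda>l. h l (J l) * y l"]
    unfolding selection_sum_def by (simp only: finite_atLeastAtMost fun_upd_same)
qed

lemma selection_sum_upd_value:
  assumes "i \<in> {1..m}"
  shows "selection_sum m h J (y(i := t)) = selection_sum m h J y + h i (J i) * (t - y i)"
  using selection_sum_upd[OF assms, of h J "J i" y t] by (simp add: algebra_simps)

locale knapsack_blocks =
  fixes m :: nat and n :: "nat \<Rightarrow> nat" and a :: "nat \<Rightarrow> nat \<Rightarrow> real" and b :: real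
    and pos :: "nat \<times> nat \<Rightarrow> 'k::finite"
  assumes pos: "bij_betw pos (index_set m n) UNIV"
    and n_pos: "i \<in> {1..m} \<Longrightarrow> n i \<ge> 1"
    and b_pos: "b > 0"
    and a_nonneg: "i \<in> {1..m} \<Longrightarrow> j \<in> {1..n i} \<Longrightarrow> a i j \<ge> 0"
begin

definition vector_of :: "(nat \<Rightarrow> nat \<Rightarrow> real) \<Rightarrow> real ^ 'k" where
  "vector_of h = (\<chi> k. case inv_into (index_set m n) pos k of (i, j) \<Rightarrow> h i j)"

lemma vector_of_nth:
  assumes "i \<in> {1..m}" "j \<in> {1..n i}"
  shows "vector_of h $ pos (i, j) = h i j"
proof -
  have "(i, j) \<in> index_set m n"
    using assms by (simp add: index_set_def)
  then have "inv_into (index_set m n) pos (pos (i, j)) = (i, j)"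
    using pos by (simp add: bij_betw_def)
  then show ?thesis by (simp add: vector_of_def)
qed

lemma pos_cases:
  obtains i j where "i \<in> {1..m}" "j \<in> {1..n i}" "k = pos (i, j)"
proof -
  have "k \<in> pos ` index_set m n"
    using pos by (simp add: bij_betw_def)
  then show ?thesis using that by (auto simp: index_set_def)
qed

lemma inner_eq_block_sum:
  "g \<bullet> x = (\<Sum>i\<in>{1..m}. \<Sum>j\<in>{1..n i}. g $ pos (i, j) * x $ pos (i, j))"
proof -
  have "g \<bullet> x = (\<Sum>k\<in>UNIV. g $ k * x $ k)"
    by (simp add: inner_vec_def)
  also have "\<dots> = (\<Sum>q\<in>index_set m n. g $ pos q * x $ pos q)"
    using sum.reindex_bij_betw[OF pos, of "\<lambda>k. g $ k * x $ k"] by simp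
  also have "\<dots> = (\<Sum>i\<in>{1..m}. \<Sum>j\<in>{1..n i}. g $ pos (i, j) * x $ pos (i, j))"
    unfolding index_set_def by (simp add: sum.Sigma split_def)
  finally show ?thesis .
qed

text \<open>Complementarity is built into the encoding, which leaves the bounds and the knapsack
  constraint. A point with a zero block has several representations.\<close>

definition feasible_selection :: "(nat \<Rightarrow> nat) \<Rightarrow> (nat \<Rightarrow> real) \<Rightarrow> bool" where
  "feasible_selection J y \<longleftrightarrow>
     (\<forall>i\<in>{1..m}. J i \<in> {1..n i} \<and> 0 \<le> y i \<and> y i \<le> 1) \<and> selection_sum m a J y \<le> b"

definition selection_vector :: "(nat \<Rightarrow> nat) \<Rightarrow> (nat \<Rightarrow> real) \<Rightarrow> real ^ 'k" where
  "selection_vector J y = vector_of (\<lambda>i j. if j = J i then y i else 0)"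

lemma block_sum_selection:
  assumes J: "\<And>i. i \<in> {1..m} \<Longrightarrow> J i \<in> {1..n i}"
  shows "(\<Sum>i\<in>{1..m}. \<Sum>j\<in>{1..n i}. h i j * selection_vector J y $ pos (i, j)) = selection_sum m h J y"
  unfolding selection_sum_def
proof (rule sum.cong)
  fix i assume i: "i \<in> {1..m}"
  have "(\<Sum>j\<in>{1..n i}. h i j * selection_vector J y $ pos (i, j)) =
      (\<Sum>j\<in>{1..n i}. if j = J i then h i (J i) * y i else 0)"
    using i by (intro sum.cong) (auto simp: selection_vector_def vector_of_nth)
  also have "\<dots> = h i (J i) * y i"
    using J[OF i] by simp
  finally show "(\<Sum>j\<in>{1..n i}. h i j * selection_vector J y $ pos (i, j)) = h i (J i) * y i" .
qed simp

lemma inner_selection_vector: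
  assumes "feasible_selection J y"
  shows "g \<bullet> selection_vector J y = selection_sum m (\<lambda>i j. g $ pos (i, j)) J y"
  unfolding inner_eq_block_sum using assms
  by (intro block_sum_selection) (auto simp: feasible_selection_def)

lemma inner_vector_of_selection:
  assumes "feasible_selection J y"
  shows "vector_of h \<bullet> selection_vector J y = selection_sum m h J y"
  unfolding inner_selection_vector[OF assms] selection_sum_def
  using assms by (intro sum.cong) (auto simp: vector_of_nth feasible_selection_def)

lemma selection_vector_feasible:
  assumes "feasible_selection J y"
  shows "selection_vector J y \<in> feasible_set m n a b pos"
proof -
  have J: "J i \<in> {1..n i}" and y: "0 \<le> y i" "y i \<le> 1" if "i \<in> {1..m}" for i
    using assms that by (auto simp: feasible_selection_def)
  have nth: "selection_vector J y $ pos (i, j) = (if j = J i then y i else 0)"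
    if "i \<in> {1..m}" "j \<in> {1..n i}" for i j
    using that by (simp add: selection_vector_def vector_of_nth)
  have "0 \<le> selection_vector J y $ k \<and> selection_vector J y $ k \<le> 1" for k
    by (rule pos_cases[of k]) (use nth y in auto)
  moreover have "(\<Sum>i\<in>{1..m}. \<Sum>j\<in>{1..n i}. a i j * selection_vector J y $ pos (i, j)) \<le> b"
    using assms J by (subst block_sum_selection) (auto simp: feasible_selection_def)
  ultimately show ?thesis
    unfolding feasible_set_def using nth by auto
qed

text \<open>Complementarity allows at most one nonzero coordinate per block, and \<open>J\<close>
  picks it.\<close>

lemma feasible_setE:
  assumes x: "x \<in> feasible_set m n a b pos"
  obtains J y where "feasible_selection J y" "x = selection_vector J y"
proof -
  have compl: "x $ pos (i, j) * x $ pos (i, j') = 0"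
    if "i \<in> {1..m}" "j \<in> {1..n i}" "j' \<in> {1..n i}" "j \<noteq> j'" for i j j'
    using x that unfolding feasible_set_def mem_Collect_eq by meson
  have "\<exists>j\<in>{1..n i}. \<forall>j'\<in>{1..n i}. j' \<noteq> j \<longrightarrow> x $ pos (i, j') = 0" if i: "i \<in> {1..m}" for i
  proof (cases "\<exists>j\<in>{1..n i}. x $ pos (i, j) \<noteq> 0")
    case True
    then obtain j where j: "j \<in> {1..n i}" "x $ pos (i, j) \<noteq> 0" by blast
    have "x $ pos (i, j') = 0" if "j' \<in> {1..n i}" "j' \<noteq> j" for j'
      using compl[OF i j(1) that(1)] j(2) that(2) by simp
    then show ?thesis using j(1) by blast
  next
    case False
    \<comment> \<open>In a block of zeros the first index is chosen.\<close>
    moreover have "1 \<in> {1..n i}" using n_pos[OF i] by simp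
    ultimately show ?thesis by blast
  qed
  then obtain J where J: "\<And>i. i \<in> {1..m} \<Longrightarrow> J i \<in> {1..n i}"
      "\<And>i j'. i \<in> {1..m} \<Longrightarrow> j' \<in> {1..n i} \<Longrightarrow> j' \<noteq> J i \<Longrightarrow> x $ pos (i, j') = 0"
    by metis
  define y where "y i = x $ pos (i, J i)" for i
  have xeq: "x = selection_vector J y"
  proof (rule vec_eq_iff[THEN iffD2], rule allI)
    fix k
    show "x $ k = selection_vector J y $ k"
      by (rule pos_cases[of k]) (auto simp: selection_vector_def vector_of_nth y_def J)
  qed
  have "selection_sum m a J y = (\<Sum>i\<in>{1..m}. \<Sum>j\<in>{1..n i}. a i j * x $ pos (i, j))"
    unfolding xeq using J by (subst block_sum_selection) auto
  then have "feasible_selection J y"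
    using x J by (auto simp: feasible_selection_def feasible_set_def y_def)
  then show ?thesis using xeq that by blast
qed

section \<open>Full dimension of the polytope\<close>

text \<open>The polytope contains the origin and a positive multiple of every unit vector.\<close>

lemma aff_dim_ck_polytope: "aff_dim (ck_polytope m n a b pos) = int CARD('k)"
proof -
  define C where "C = ck_polytope m n a b pos"
  have CI: "selection_vector J y \<in> C" if "feasible_selection J y" for J y
    unfolding C_def ck_polytope_def using selection_vector_feasible[OF that] by (rule hull_inc)
  \<comment> \<open>The function \<open>n\<close> itself is a selection: it takes the last index of
    each block.\<close>
  have "selection_vector n (\<lambda>_. 0) = 0"
    by (simp add: selection_vector_def vector_of_def vec_eq_iff split_def)
  moreover have "feasible_selection n (\<lambda>_. 0)"
    using b_pos n_pos by (auto simp: feasible_selection_def selection_sum_def)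
  ultimately have zero: "0 \<in> C" using CI by metis
  have "axis k 1 \<in> span C" for k
  proof -
    obtain i j where ij: "i \<in> {1..m}" "j \<in> {1..n i}" "k = pos (i, j)"
      by (rule pos_cases)
    \<comment> \<open>This value is positive, at most 1 and of weight at most \<open>b\<close>, also
      when \<open>a i j\<close> is 0.\<close>
    define \<epsilon> where "\<epsilon> = b / (a i j + b)"
    have \<epsilon>: "0 < \<epsilon>" "\<epsilon> \<le> 1" "a i j * \<epsilon> \<le> b"
      using b_pos a_nonneg[OF ij(1,2)] by (auto simp: \<epsilon>_def field_simps)
    have sel: "feasible_selection (n(i := j)) ((\<lambda>_. 0)(i := \<epsilon>))"
      unfolding feasible_selection_def selection_sum_upd[OF ij(1)]
      using \<epsilon> ij n_pos by (auto simp: selection_sum_def)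
    have "selection_vector (n(i := j)) ((\<lambda>_. 0)(i := \<epsilon>)) = \<epsilon> *\<^sub>R axis k 1"
    proof (rule vec_eq_iff[THEN iffD2], rule allI)
      fix k'
      obtain i' j' where ij': "i' \<in> {1..m}" "j' \<in> {1..n i'}" "k' = pos (i', j')"
        by (rule pos_cases)
      have "pos (i', j') = pos (i, j) \<longleftrightarrow> (i', j') = (i, j)"
        using pos ij ij' by (intro inj_on_eq_iff[of pos "index_set m n"]) (auto simp: bij_betw_def index_set_def)
      then show "selection_vector (n(i := j)) ((\<lambda>_. 0)(i := \<epsilon>)) $ k' = (\<epsilon> *\<^sub>R axis k 1 :: real ^ 'k) $ k'"
        using ij ij' by (auto simp: selection_vector_def vector_of_nth axis_def)
    qed
    then have "\<epsilon> *\<^sub>R axis k 1 \<in> span C"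
      using CI[OF sel] span_base by metis
    then show ?thesis
      using \<epsilon>(1) span_mul[of "\<epsilon> *\<^sub>R axis k 1" C "1 / \<epsilon>"] by simp
  qed
  then have "Basis \<subseteq> span C"
    by (auto simp: Basis_vec_def)
  then have "span C = UNIV"
    by (metis span_Basis span_mono span_span top.extremum_uniqueI)
  then have "dim C = CARD('k)"
    by (metis dim_span dim_UNIV DIM_cart DIM_real mult.right_neutral)
  then show ?thesis
    using zero by (simp add: aff_dim_zero hull_inc C_def)
qed

end

section \<open>The inequality of a pack and its validity\<close>

text \<open>The block set \<open>M\<^sub>P\<close> is \<open>Q\<close>, \<open>K\<close> is its part outside \<open>M\<^sub>0\<close>, and the pack is
  \<open>{(i, p i) | i \<in> Q}\<close>.\<close>

locale pack_inequality = knapsack_blocks m n a b pos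
  for m :: nat and n :: "nat \<Rightarrow> nat" and a :: "nat \<Rightarrow> nat \<Rightarrow> real" and b :: real
    and pos :: "nat \<times> nat \<Rightarrow> 'k::finite" +
  fixes Q K :: "nat set" and p :: "nat \<Rightarrow> nat" and i0 :: nat and s :: real
  assumes Q: "Q \<subseteq> {1..m}" and K: "K \<subseteq> Q" and i0: "i0 \<in> K"
    and card_K: "card K \<ge> 2"
    and p: "i \<in> Q \<Longrightarrow> p i \<in> {1..n i}"
    and singleton: "i \<in> Q - K \<Longrightarrow> n i = 1"
    and min_i0: "j \<in> {1..n i0} \<Longrightarrow> a i0 (p i0) \<le> a i0 j"
    and s_eq: "s = (\<Sum>i\<in>Q. a i (p i))" and s_less: "s < b"
begin

definition \<delta> :: real where "\<delta> = b - s"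

text \<open>In block \<open>i0\<close> one formula covers the pack index too: there the quotient is
  at most 1, so the maximum is 1 and the coefficient is \<open>a i0 (p i0)\<close>.\<close>

definition coef :: "nat \<Rightarrow> nat \<Rightarrow> real" where
  "coef i j =
    (if i \<notin> Q then 0
     else if i = i0 then a i0 (p i0) * max 1 (a i0 j / (a i0 (p i0) + \<delta>))
     else a i j + (if i \<in> K \<and> j = p i then \<delta> else 0))"

definition bound :: real where "bound = b + (real (card K) - 2) * \<delta>"

lemma \<delta>_pos: "\<delta> > 0" using s_less by (simp add: \<delta>_def)

lemma finite_Q: "finite Q"
  using Q by (rule finite_subset) simp

lemma finite_K: "finite K"
  using K finite_Q by (rule finite_subset)

lemma i0_Q: "i0 \<in> Q" and i0_m: "i0 \<in> {1..m}"
  using i0 K Q by auto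

lemma w_nonneg: "a i0 (p i0) \<ge> 0"
  by (rule a_nonneg[OF i0_m p[OF i0_Q]])

text \<open>Separates the block \<open>i0\<close>, the knapsack weights of the other blocks, and the
  bonus \<delta> for staying in the pack, which are estimated by different means.\<close>

lemma selection_sum_coef:
  "selection_sum m coef J y = coef i0 (J i0) * y i0 + (\<Sum>i\<in>Q - {i0}. a i (J i) * y i)
     + \<delta> * (\<Sum>i\<in>K - {i0}. if J i = p i then y i else 0)"
proof -
  have "selection_sum m coef J y = (\<Sum>i\<in>Q. coef i (J i) * y i)"
    unfolding selection_sum_def using Q by (intro sum.mono_neutral_right) (auto simp: coef_def)
  also have "\<dots> = coef i0 (J i0) * y i0 + (\<Sum>i\<in>Q - {i0}. coef i (J i) * y i)"
    using i0_Q finite_Q by (simp add: sum.remove)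
  also have "(\<Sum>i\<in>Q - {i0}. coef i (J i) * y i) =
      (\<Sum>i\<in>Q - {i0}. a i (J i) * y i + (if i \<in> K then \<delta> * (if J i = p i then y i else 0) else 0))"
    by (intro sum.cong) (auto simp: coef_def algebra_simps)
  also have "\<dots> = (\<Sum>i\<in>Q - {i0}. a i (J i) * y i)
      + (\<Sum>i\<in>(Q - {i0}) \<inter> K. \<delta> * (if J i = p i then y i else 0))"
    using finite_Q by (simp add: sum.distrib sum.inter_restrict)
  also have "(Q - {i0}) \<inter> K = K - {i0}" using K by auto
  finally show ?thesis by (simp add: sum_distrib_left)
qed

lemma selection_sum_coef_le:
  assumes "feasible_selection J y"
  shows "selection_sum m coef J y \<le> bound"
proof -
  have J: "J i \<in> {1..n i}" and y: "0 \<le> y i" "y i \<le> 1" if "i \<in> {1..m}" for i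
    using assms that by (auto simp: feasible_selection_def)
  define w where "w = a i0 (p i0)"
  define u where "u = a i0 (J i0)"
  define A where "A = (\<Sum>i\<in>Q - {i0}. a i (J i) * y i)"
  define D where "D = (\<Sum>i\<in>K - {i0}. if J i = p i then y i else 0)"
  have w: "0 \<le> w" "w \<le> u"
    using w_nonneg min_i0 J[OF i0_m] by (auto simp: w_def u_def)
  have "A + u * y i0 = (\<Sum>i\<in>Q. a i (J i) * y i)"
    using i0_Q finite_Q by (simp add: sum.remove A_def u_def)
  also have "\<dots> \<le> selection_sum m a J y"
    unfolding selection_sum_def using Q a_nonneg J y by (intro sum_mono2) auto
  finally have knap: "A + u * y i0 \<le> b"
    using assms by (simp add: feasible_selection_def)
  have f: "selection_sum m coef J y = w * max 1 (u / (w + \<delta>)) * y i0 + A + \<delta> * D"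
    unfolding selection_sum_coef A_def D_def using i0_Q by (simp add: coef_def w_def u_def)
  have yK: "0 \<le> y i" "y i \<le> 1" if "i \<in> K" for i
    using that K Q y by auto
  have card_i0: "card (K - {i0}) = card K - 1"
    using i0 finite_K by simp
  show ?thesis
  proof (cases "\<exists>l\<in>K - {i0}. J l \<noteq> p l")
    case True
    then obtain l where l: "l \<in> K - {i0}" "J l \<noteq> p l" by blast
    \<comment> \<open>Block \<open>l\<close> earns no bonus, so besides \<open>i0\<close> a second
      element of \<open>K\<close> drops out of the count.\<close>
    have "D = (\<Sum>i\<in>K - {i0} - {l}. if J i = p i then y i else 0)"
      unfolding D_def using l finite_K by (simp add: sum.remove[of "K - {i0}" l])
    also have "\<dots> \<le> (\<Sum>i\<in>K - {i0} - {l}. 1)"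
      using yK by (intro sum_mono) auto
    also have "\<dots> = real (card K) - 2"
      using l card_i0 finite_K card_K by (simp add: of_nat_diff)
    finally have "\<delta> * D \<le> (real (card K) - 2) * \<delta>"
      using \<delta>_pos by (simp add: mult.commute)
    \<comment> \<open>The coefficient in block \<open>i0\<close> never exceeds the knapsack weight
      \<open>u\<close>: both \<open>w \<le> u\<close> and \<open>w / (w + \<delta>) \<le> 1\<close>
      hold. Hence the knapsack constraint bounds everything except the bonus.\<close>
    moreover have "w * max 1 (u / (w + \<delta>)) \<le> u"
    proof (cases "u / (w + \<delta>) \<le> 1")
      case False
      have "w * (u / (w + \<delta>)) = u * (w / (w + \<delta>))" by simp
      also have "\<dots> \<le> u * 1"
        using w \<delta>_pos by (intro mult_left_mono) auto
      finally show ?thesis using False by (simp add: max_def)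
    qed (use w in \<open>simp add: max_def\<close>)
    then have "w * max 1 (u / (w + \<delta>)) * y i0 \<le> u * y i0"
      using y[OF i0_m] by (simp add: mult_right_mono)
    ultimately show ?thesis
      using f knap by (simp add: bound_def)
  next
    case False
    \<comment> \<open>Blocks of \<open>Q\<close> outside \<open>K\<close> have a single index, so
      they agree with the pack automatically.\<close>
    have Jp: "J i = p i" if "i \<in> Q - {i0}" for i
    proof (cases "i \<in> K")
      case True
      then show ?thesis using False that by blast
    next
      case False
      then have "n i = 1" "J i \<in> {1..n i}" "p i \<in> {1..n i}"
        using that singleton J[of i] p[of i] Q by auto
      then show ?thesis by simp
    qed
    have "A \<le> (\<Sum>i\<in>Q - {i0}. a i (p i))"
      unfolding A_def using Jp Q p a_nonneg y
      by (intro sum_mono) (auto simp: mult_left_le subset_iff)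
    also have "\<dots> = s - w"
      using i0_Q finite_Q by (simp add: s_eq sum.remove w_def)
    finally have A: "A \<le> s - w" .
    have "D \<le> (\<Sum>i\<in>K - {i0}. 1)"
      unfolding D_def using yK by (intro sum_mono) auto
    also have "\<dots> = real (card K) - 1"
      using card_i0 card_K by (simp add: of_nat_diff)
    finally have D: "\<delta> * D \<le> (real (card K) - 1) * \<delta>"
      using \<delta>_pos by (simp add: mult.commute)
    have "w * max 1 (u / (w + \<delta>)) * y i0 + A \<le> s"
    proof (cases "u / (w + \<delta>) \<le> 1")
      case True
      have "w * y i0 \<le> w" using w y[OF i0_m] by (simp add: mult_left_le)
      then show ?thesis using A True by (simp add: max_def)
    next
      case False
      have wd: "w + \<delta> > 0" using w \<delta>_pos by simp
      \<comment> \<open>The knapsack constraint gives \<open>u * y i0 \<le> b - A\<close>. The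
        resulting bound \<open>w * (b - A) / (w + \<delta>) + A\<close> increases with
        \<open>A\<close> and equals \<open>s\<close> at \<open>A = s - w\<close>; the argument is
        carried out after multiplication by \<open>w + \<delta>\<close>.\<close>
      have "w * (u * y i0) \<le> w * (b - A)"
        using w knap by (intro mult_left_mono) auto
      moreover have "\<delta> * A \<le> \<delta> * (s - w)"
        using A \<delta>_pos by simp
      moreover have "w * (b - A) + \<delta> * (s - w) + A * w = s * (w + \<delta>)"
        by (simp add: \<delta>_def algebra_simps)
      ultimately have "w * (u * y i0) + A * (w + \<delta>) \<le> s * (w + \<delta>)"
        by (simp add: algebra_simps)
      then have "w * (u / (w + \<delta>)) * y i0 + A \<le> s"
        using wd by (simp add: field_simps)
      then show ?thesis using False by (simp add: max_def)
    qed
    then have "selection_sum m coef J y \<le> s + (real (card K) - 1) * \<delta>"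
      using f D by linarith
    also have "\<dots> = bound" by (simp add: bound_def \<delta>_def algebra_simps)
    finally show ?thesis .
  qed
qed

lemma inner_coef_le:
  assumes "x \<in> ck_polytope m n a b pos"
  shows "vector_of coef \<bullet> x \<le> bound"
proof -
  have "feasible_set m n a b pos \<subseteq> {x. vector_of coef \<bullet> x \<le> bound}"
  proof
    fix x assume "x \<in> feasible_set m n a b pos"
    then obtain J y where Jy: "feasible_selection J y" "x = selection_vector J y"
      by (rule feasible_setE)
    then show "x \<in> {x. vector_of coef \<bullet> x \<le> bound}"
      using selection_sum_coef_le[OF Jy(1)] by (simp add: inner_vector_of_selection)
  qed
  then have "ck_polytope m n a b pos \<subseteq> {x. vector_of coef \<bullet> x \<le> bound}"
    unfolding ck_polytope_def by (intro hull_minimal) (auto simp: convex_halfspace_le)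
  then show ?thesis using assms by blast
qed

lemma coef_i0_p: "coef i0 (p i0) = a i0 (p i0)"
proof -
  have "a i0 (p i0) / (a i0 (p i0) + \<delta>) \<le> 1"
    using w_nonneg \<delta>_pos by simp
  then show ?thesis using i0_Q by (simp add: coef_def max_def)
qed

text \<open>Brings the inner product into the shape of the displayed inequality, to identify it with
  the given left-hand side.\<close>

lemma inner_coef:
  "vector_of coef \<bullet> x =
     (\<Sum>i\<in>Q - {i0}. \<Sum>j\<in>{1..n i}. a i j * x $ pos (i, j))
   + (\<Sum>i\<in>K - {i0}. \<delta> * x $ pos (i, p i))
   + a i0 (p i0) * x $ pos (i0, p i0)
   + (\<Sum>j\<in>{1..n i0} - {p i0}.
        a i0 (p i0) * max 1 (a i0 j / (a i0 (p i0) + \<delta>)) * x $ pos (i0, j))"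
proof -
  define S where "S i = (\<Sum>j\<in>{1..n i}. coef i j * x $ pos (i, j))" for i
  have "vector_of coef \<bullet> x = (\<Sum>i\<in>{1..m}. S i)"
    unfolding inner_eq_block_sum S_def by (intro sum.cong) (auto simp: vector_of_nth)
  also have "\<dots> = (\<Sum>i\<in>Q. S i)"
    using Q by (intro sum.mono_neutral_right) (auto simp: coef_def S_def)
  also have "\<dots> = S i0 + (\<Sum>i\<in>Q - {i0}. S i)"
    using i0_Q finite_Q by (simp add: sum.remove)
  also have "(\<Sum>i\<in>Q - {i0}. S i) = (\<Sum>i\<in>Q - {i0}.
      (\<Sum>j\<in>{1..n i}. a i j * x $ pos (i, j)) + (if i \<in> K then \<delta> * x $ pos (i, p i) else 0))"
  proof (rule sum.cong)
    fix i assume i: "i \<in> Q - {i0}"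
    then have pi: "p i \<in> {1..n i}" using p by blast
    have "S i = (\<Sum>j\<in>{1..n i}. a i j * x $ pos (i, j)
        + (if j = p i then (if i \<in> K then \<delta> * x $ pos (i, p i) else 0) else 0))"
      unfolding S_def using i by (intro sum.cong) (auto simp: coef_def algebra_simps)
    also have "\<dots> = (\<Sum>j\<in>{1..n i}. a i j * x $ pos (i, j))
        + (if i \<in> K then \<delta> * x $ pos (i, p i) else 0)"
      using pi by (simp add: sum.distrib)
    finally show "S i = (\<Sum>j\<in>{1..n i}. a i j * x $ pos (i, j))
        + (if i \<in> K then \<delta> * x $ pos (i, p i) else 0)" .
  qed simp
  also have "\<dots> = (\<Sum>i\<in>Q - {i0}. \<Sum>j\<in>{1..n i}. a i j * x $ pos (i, j))
      + (\<Sum>i\<in>(Q - {i0}) \<inter> K. \<delta> * x $ pos (i, p i))"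
    using finite_Q by (simp add: sum.distrib sum.inter_restrict)
  also have "(Q - {i0}) \<inter> K = K - {i0}" using K by auto
  also have "S i0 = a i0 (p i0) * x $ pos (i0, p i0) + (\<Sum>j\<in>{1..n i0} - {p i0}.
        a i0 (p i0) * max 1 (a i0 j / (a i0 (p i0) + \<delta>)) * x $ pos (i0, j))"
  proof -
    have "S i0 = coef i0 (p i0) * x $ pos (i0, p i0)
        + (\<Sum>j\<in>{1..n i0} - {p i0}. coef i0 j * x $ pos (i0, j))"
      unfolding S_def using p[OF i0_Q] by (simp add: sum.remove)
    also have "(\<Sum>j\<in>{1..n i0} - {p i0}. coef i0 j * x $ pos (i0, j)) =
        (\<Sum>j\<in>{1..n i0} - {p i0}.
          a i0 (p i0) * max 1 (a i0 j / (a i0 (p i0) + \<delta>)) * x $ pos (i0, j))"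
      using i0_Q by (intro sum.cong) (auto simp: coef_def)
    finally show ?thesis by (simp only: coef_i0_p)
  qed
  finally show ?thesis by simp
qed

end

section \<open>Tight points of a maximal switching pack\<close>

text \<open>\<open>switching\<close> is the maximality condition
  \<open>s - a i (p i) + a i j > b\<close>, rearranged and stated for all indices outside the pack;
  sortedness extends it from the next-to-last index to the earlier ones.\<close>

locale switching_pack_inequality = pack_inequality m n a b pos Q K p i0 s
  for m :: nat and n :: "nat \<Rightarrow> nat" and a :: "nat \<Rightarrow> nat \<Rightarrow> real" and b :: real
    and pos :: "nat \<times> nat \<Rightarrow> 'k::finite" and Q K :: "nat set" and p :: "nat \<Rightarrow> nat"
    and i0 :: nat and s :: real +
  assumes switching: "i \<in> K \<Longrightarrow> j \<in> {1..n i} \<Longrightarrow> j \<noteq> p i \<Longrightarrow> a i j > a i (p i) + \<delta>"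
    and alternative: "i \<in> K \<Longrightarrow> \<exists>j\<in>{1..n i}. j \<noteq> p i"
    and nondegenerate: "a i0 (p i0) > 0 \<or> card K = 2 \<or> (\<exists>l\<in>Q - K. a l (p l) > 0)"
begin

definition tight :: "(nat \<Rightarrow> nat) \<Rightarrow> (nat \<Rightarrow> real) \<Rightarrow> bool" where
  "tight J y \<longleftrightarrow> feasible_selection J y \<and> selection_sum m coef J y = bound"

text \<open>Together with \<open>y0\<close> this is the characteristic vector of the pack. Outside
  \<open>Q\<close>, where \<open>y0\<close> vanishes, the value 1 keeps \<open>J0\<close> inside the
  block.\<close>

definition J0 :: "nat \<Rightarrow> nat" where "J0 i = (if i \<in> Q then p i else 1)"

definition y0 :: "nat \<Rightarrow> real" where "y0 i = (if i \<in> Q then 1 else 0)"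

lemma selection_sum_base: "selection_sum m h J0 y0 = (\<Sum>i\<in>Q. h i (p i))"
proof -
  have "selection_sum m h J0 y0 = (\<Sum>i\<in>{1..m}. if i \<in> Q then h i (p i) else 0)"
    unfolding selection_sum_def by (intro sum.cong) (auto simp: J0_def y0_def)
  also have "\<dots> = (\<Sum>i\<in>{1..m} \<inter> Q. h i (p i))" by (simp add: sum.inter_restrict)
  also have "{1..m} \<inter> Q = Q" using Q by auto
  finally show ?thesis .
qed

lemma J0_range: "i \<in> {1..m} \<Longrightarrow> J0 i \<in> {1..n i}"
  using p n_pos by (auto simp: J0_def)

lemma base_weight: "selection_sum m a J0 y0 = s"
  by (simp add: selection_sum_base s_eq)

text \<open>The pack contributes its weight \<open>s\<close> and one bonus \<delta> for each element
  of \<open>K\<close> except \<open>i0\<close>; since \<open>s + \<delta> = b\<close>, this is the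
  bound.\<close>

lemma base_coef: "selection_sum m coef J0 y0 = bound"
proof -
  have "(\<Sum>i\<in>Q - {i0}. a i (J0 i) * y0 i) = (\<Sum>i\<in>Q - {i0}. a i (p i))"
    by (intro sum.cong) (auto simp: J0_def y0_def)
  also have "\<dots> = s - a i0 (p i0)"
    using i0_Q finite_Q by (simp add: s_eq sum.remove)
  finally have A: "(\<Sum>i\<in>Q - {i0}. a i (J0 i) * y0 i) = s - a i0 (p i0)" .
  have "(\<Sum>i\<in>K - {i0}. if J0 i = p i then y0 i else 0) = (\<Sum>i\<in>K - {i0}. 1)"
    using K by (intro sum.cong) (auto simp: J0_def y0_def)
  also have "\<dots> = real (card K) - 1"
    using i0 finite_K card_K by (simp add: of_nat_diff)
  finally have D: "(\<Sum>i\<in>K - {i0}. if J0 i = p i then y0 i else 0) = real (card K) - 1" .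
  have "coef i0 (J0 i0) * y0 i0 = a i0 (p i0)"
    using i0_Q coef_i0_p by (simp add: J0_def y0_def)
  then show ?thesis
    unfolding selection_sum_coef A D
    by (simp add: bound_def \<delta>_def algebra_simps)
qed

lemma tight_base: "tight J0 y0"
  using base_coef base_weight J0_range s_less
  by (auto simp: tight_def feasible_selection_def y0_def)

text \<open>Blocks outside \<open>Q\<close> have coefficient 0, so the slack \<delta> of the pack
  may be spent there. The chosen value is positive, at most 1, and has weight at most
  \<delta>.\<close>

lemma tight_outside:
  assumes l: "l \<in> {1..m} - Q" and j: "j \<in> {1..n l}"
  shows "tight (J0(l := j)) (y0(l := \<delta> / (a l j + \<delta>)))"
proof -
  have l': "l \<in> {1..m}" using l by simp
  have anon: "a l j \<ge> 0" using a_nonneg l' j by blast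
  have t: "0 \<le> \<delta> / (a l j + \<delta>)" "\<delta> / (a l j + \<delta>) \<le> 1" "a l j * (\<delta> / (a l j + \<delta>)) \<le> \<delta>"
    using anon \<delta>_pos by (auto simp: field_simps)
  have "y0 l = 0" using l by (simp add: y0_def)
  moreover have "coef l j = 0" using l by (simp add: coef_def)
  ultimately show ?thesis
    unfolding tight_def feasible_selection_def selection_sum_upd[OF l'] base_weight base_coef
    using t j J0_range by (auto simp: y0_def \<delta>_def)
qed

text \<open>The value makes block \<open>i0\<close> weigh \<open>a i0 (p i0) + \<delta>\<close>,
  which fills the knapsack exactly. By \<open>switching\<close> the maximum in \<open>coef\<close>
  is the quotient, so the block still contributes \<open>a i0 (p i0)\<close>.\<close>

lemma tight_switch_i0:
  assumes j: "j \<in> {1..n i0}" "j \<noteq> p i0"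
  shows "tight (J0(i0 := j)) (y0(i0 := (a i0 (p i0) + \<delta>) / a i0 j))"
proof -
  define t where "t = (a i0 (p i0) + \<delta>) / a i0 j"
  have gt: "a i0 j > a i0 (p i0) + \<delta>" using switching[OF i0 j] .
  have wd: "a i0 (p i0) + \<delta> > 0" using w_nonneg \<delta>_pos by linarith
  have t: "0 \<le> t" "t \<le> 1" "a i0 j * t = a i0 (p i0) + \<delta>"
    using gt wd by (auto simp: t_def)
  have "a i0 j / (a i0 (p i0) + \<delta>) \<ge> 1" using gt wd by simp
  then have "coef i0 j * t = a i0 (p i0)"
    using i0_Q gt wd by (simp add: coef_def t_def max_def)
  then show ?thesis
    unfolding t_def[symmetric] tight_def feasible_selection_def selection_sum_upd[OF i0_m]
      base_weight base_coef
    using t j J0_range i0_Q coef_i0_p by (auto simp: y0_def J0_def \<delta>_def)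
qed

text \<open>Switching block \<open>i\<close> away from the pack exhausts the knapsack, and since \<open>switching\<close> is strict
  some weight \<open>\<epsilon> * a l (p l)\<close> can still be moved from a block \<open>l\<close> whose coefficient is its
  knapsack weight to block \<open>i\<close>.\<close>
lemma tight_switch:
  assumes i: "i \<in> K" "i \<noteq> i0" and j: "j \<in> {1..n i}" "j \<noteq> p i"
    and l: "l \<in> insert i0 (Q - K)"
    and \<epsilon>: "0 \<le> \<epsilon>" "\<epsilon> \<le> 1" "\<epsilon> * a l (p l) \<le> a i j - a i (p i) - \<delta>"
  shows "tight (J0(i := j)) (y0(i := (a i (p i) + \<delta> + \<epsilon> * a l (p l)) / a i j, l := 1 - \<epsilon>))"
proof -
  define t where "t = (a i (p i) + \<delta> + \<epsilon> * a l (p l)) / a i j"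
  have iQ: "i \<in> Q" "i \<in> {1..m}" using i K Q by auto
  have lQ: "l \<in> Q" "l \<in> {1..m}" using l i0_Q Q by auto
  have il: "i \<noteq> l" using i l by auto
  have nn: "a i (p i) \<ge> 0" "a l (p l) \<ge> 0"
    using a_nonneg p iQ lQ by blast+
  have gt: "a i j > a i (p i) + \<delta>" using switching[OF i(1) j] .
  then have pos: "a i j > 0" using nn(1) \<delta>_pos by linarith
  have "a i (p i) + \<delta> + \<epsilon> * a l (p l) \<ge> 0"
    using nn \<delta>_pos \<epsilon>(1) by simp
  then have t: "0 \<le> t" "t \<le> 1" "a i j * t = a i (p i) + \<delta> + \<epsilon> * a l (p l)"
    using pos \<epsilon>(3) by (auto simp: t_def)
  have cij: "coef i j = a i j" and cip: "coef i (p i) = a i (p i) + \<delta>"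
    using iQ i j by (auto simp: coef_def)
  have cl: "coef l (p l) = a l (p l)"
  proof (cases "l = i0")
    case True
    then show ?thesis using coef_i0_p by simp
  next
    case False
    then show ?thesis using l lQ by (simp add: coef_def)
  qed
  have val: "J0 i = p i" "y0 i = 1" "J0 l = p l" "y0 l = 1"
    using iQ lQ by (auto simp: J0_def y0_def)
  have sums: "selection_sum m h (J0(i := j)) (y0(i := t, l := 1 - \<epsilon>)) =
      selection_sum m h J0 y0 - h i (p i) + h i j * t - \<epsilon> * h l (p l)" for h
    unfolding selection_sum_upd_value[OF lQ(2)] selection_sum_upd[OF iQ(2)]
    using il val by simp
  \<comment> \<open>The knapsack weight becomes \<open>s + \<delta> = b\<close>. In
    \<open>coef\<close> the lost bonus of block \<open>i\<close> is made up by the additional weight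
    \<delta> packed into it, and the weight moved from \<open>l\<close> cancels.\<close>
  show ?thesis
    unfolding t_def[symmetric] tight_def feasible_selection_def sums base_weight base_coef cij cip cl
    using t j J0_range \<epsilon> by (auto simp: y0_def \<delta>_def)
qed

section \<open>Functionals constant on the tight points\<close>

text \<open>Each family of tight points, compared with the base point, gives a linear equation for
  \<open>G\<close>; together these equations determine \<open>G\<close> up to a scalar.\<close>

lemma proportional_to_coef:
  assumes G: "\<And>J y. tight J y \<Longrightarrow> selection_sum m G J y = \<gamma>"
  shows "\<exists>\<mu>. \<forall>i\<in>{1..m}. \<forall>j\<in>{1..n i}. G i j = \<mu> * coef i j"
proof -
  have base: "selection_sum m G J0 y0 = \<gamma>" using G tight_base by blast
  have outside: "G l j = 0" if l: "l \<in> {1..m} - Q" and j: "j \<in> {1..n l}" for l j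
  proof -
    have l': "l \<in> {1..m}" using l by simp
    have "a l j + \<delta> > 0" using a_nonneg[OF l' j] \<delta>_pos by linarith
    then show ?thesis
      using G[OF tight_outside[OF l j]] base l \<delta>_pos
      unfolding selection_sum_upd[OF l'] by (simp add: y0_def)
  qed
  have i0_switch: "G i0 j * (a i0 (p i0) + \<delta>) = G i0 (p i0) * a i0 j"
    if j: "j \<in> {1..n i0}" "j \<noteq> p i0" for j
  proof -
    have "a i0 j > 0" using switching[OF i0 j] w_nonneg \<delta>_pos by linarith
    then show ?thesis
      using G[OF tight_switch_i0[OF j]] base i0_Q
      unfolding selection_sum_upd[OF i0_m] by (simp add: y0_def J0_def field_simps)
  qed
  have switch: "G i j * (a i (p i) + \<delta>) = G i (p i) * a i j"
      "G l (p l) * a i j = a l (p l) * G i j"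
    if i: "i \<in> K" "i \<noteq> i0" and j: "j \<in> {1..n i}" "j \<noteq> p i" and l: "l \<in> insert i0 (Q - K)" for i j l
  proof -
    have iQ: "i \<in> Q" "i \<in> {1..m}" using i K Q by auto
    have lQ: "l \<in> Q" "l \<in> {1..m}" using l i0_Q Q by auto
    have il: "i \<noteq> l" using i l by auto
    have nn: "a i (p i) \<ge> 0" "a l (p l) \<ge> 0"
      using a_nonneg p iQ lQ by blast+
    have gt: "a i j > a i (p i) + \<delta>" using switching[OF i(1) j] .
    then have pos: "a i j > 0" using nn(1) \<delta>_pos by linarith
    have val: "J0 i = p i" "y0 i = 1" "J0 l = p l" "y0 l = 1"
      using iQ lQ by (auto simp: J0_def y0_def)
    have eq: "G i j * (a i (p i) + \<delta> + \<epsilon> * a l (p l)) = (G i (p i) + \<epsilon> * G l (p l)) * a i j"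
      if \<epsilon>: "0 \<le> \<epsilon>" "\<epsilon> \<le> 1" "\<epsilon> * a l (p l) \<le> a i j - a i (p i) - \<delta>" for \<epsilon>
      using G[OF tight_switch[OF i j l \<epsilon>]] base il val pos
      unfolding selection_sum_upd_value[OF lQ(2)] selection_sum_upd[OF iQ(2)]
      by (simp add: field_simps)
    show e0: "G i j * (a i (p i) + \<delta>) = G i (p i) * a i j"
      using eq[of 0] gt by simp
    define \<eta> where "\<eta> = a i j - a i (p i) - \<delta>"
    \<comment> \<open>A positive amount that respects the surplus \<eta> of the switch and the bound
      1, also when \<open>a l (p l)\<close> is 0. Subtracting the equation for the amount 0 isolates
      the exchange between \<open>l\<close> and \<open>i\<close>.\<close>
    define \<epsilon> where "\<epsilon> = \<eta> / (a l (p l) + \<eta>)"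
    have "\<eta> > 0" using gt by (simp add: \<eta>_def)
    then have \<epsilon>: "0 < \<epsilon>" "\<epsilon> \<le> 1" "\<epsilon> * a l (p l) \<le> \<eta>"
      using nn(2) by (auto simp: \<epsilon>_def field_simps)
    have "G i j * (a i (p i) + \<delta>) + \<epsilon> * (a l (p l) * G i j) = G i (p i) * a i j + \<epsilon> * (G l (p l) * a i j)"
      using eq[of \<epsilon>] \<epsilon> unfolding \<eta>_def by (simp add: algebra_simps)
    then have "\<epsilon> * (G l (p l) * a i j) = \<epsilon> * (a l (p l) * G i j)"
      using e0 by linarith
    then show "G l (p l) * a i j = a l (p l) * G i j"
      using \<epsilon>(1) by simp
  qed
  \<comment> \<open>For \<open>i\<close> in \<open>K - {i0}\<close> the denominator is
    \<open>coef i (p i)\<close>, so this is the factor of block \<open>i\<close>.\<close>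
  define \<mu> where "\<mu> i = G i (p i) / (a i (p i) + \<delta>)" for i
  have w\<delta>: "a i (p i) + \<delta> > 0" if "i \<in> K" for i
    using a_nonneg[of i "p i"] p[of i] that K Q \<delta>_pos by (intro add_nonneg_pos) blast+
  have G_K: "G i j = \<mu> i * a i j" if "i \<in> K" "i \<noteq> i0" "j \<in> {1..n i}" "j \<noteq> p i" for i j
    using switch(1)[OF that, of i0] w\<delta>[OF that(1)] by (simp add: \<mu>_def field_simps)
  have G_l: "G l (p l) = a l (p l) * \<mu> i"
    if i: "i \<in> K" "i \<noteq> i0" and l: "l \<in> insert i0 (Q - K)" for i l
  proof -
    obtain j where j: "j \<in> {1..n i}" "j \<noteq> p i" using alternative[OF i(1)] by blast
    have "a i j > 0" using switching[OF i(1) j] w\<delta>[OF i(1)] by linarith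
    then show ?thesis
      using switch(2)[OF i j l] G_K[OF i j] by simp
  qed
  \<comment> \<open>Either \<open>K - {i0}\<close> has one element, or a block \<open>l\<close> of
    positive weight exchanges with both \<open>i\<close> and \<open>i'\<close>, and cancelling its
    weight equates the factors.\<close>
  have \<mu>_eq: "\<mu> i = \<mu> i'" if "i \<in> K" "i \<noteq> i0" "i' \<in> K" "i' \<noteq> i0" for i i'
  proof (cases "card K = 2")
    case True
    then have "card (K - {i0}) = 1" using i0 finite_K by simp
    then show ?thesis using that by (metis card_1_singletonE Diff_iff singletonD)
  next
    case False
    then obtain l where l: "l \<in> insert i0 (Q - K)" "a l (p l) > 0"
      using nondegenerate by blast
    then show ?thesis
      using G_l[OF that(1,2) l(1)] G_l[OF that(3,4) l(1)] by simp
  qed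
  have "card (K - {i0}) > 0" using i0 finite_K card_K by simp
  then obtain i1 where i1: "i1 \<in> K" "i1 \<noteq> i0" by (metis Diff_iff card_gt_0_iff ex_in_conv singletonI)
  have "G i j = \<mu> i1 * coef i j" if i: "i \<in> {1..m}" and j: "j \<in> {1..n i}" for i j
  proof -
    consider "i \<notin> Q" | "i \<in> Q - K" | "i \<in> K" "i \<noteq> i0" "j = p i" | "i \<in> K" "i \<noteq> i0" "j \<noteq> p i"
      | "i = i0" "j = p i0" | "i = i0" "j \<noteq> p i0"
      using K by blast
    then show ?thesis
    proof cases
      case 1
      then show ?thesis using outside i j by (simp add: coef_def)
    next
      case 2
      then have "j = p i" using singleton[OF 2] j p[of i] by simp
      moreover have "i \<noteq> i0" using 2 i0 by blast
      ultimately show ?thesis using G_l[OF i1, of i] 2 by (simp add: coef_def)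
    next
      case 3
      then show ?thesis
        using \<mu>_eq[OF i1 3(1,2)] w\<delta>[OF 3(1)] K by (auto simp: coef_def \<mu>_def)
    next
      case 4
      then show ?thesis
        using \<mu>_eq[OF i1 4(1,2)] G_K j K by (auto simp: coef_def)
    next
      case 5
      then show ?thesis using G_l[OF i1, of i0] coef_i0_p by simp
    next
      case 6
      \<comment> \<open>By \<open>switching\<close> the maximum in \<open>coef\<close> is attained
        by the quotient.\<close>
      have "a i0 j / (a i0 (p i0) + \<delta>) \<ge> 1"
        using switching[OF i0] 6 j w\<delta>[OF i0] by (simp add: less_imp_le)
      then show ?thesis
        using i0_switch[of j] 6 j G_l[OF i1, of i0] w\<delta>[OF i0] i0_Q
        by (simp add: coef_def max_def field_simps)
    qed
  qed
  then show ?thesis by blast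
qed

lemma facet_of_ck_polytope:
  "{x \<in> ck_polytope m n a b pos. vector_of coef \<bullet> x = bound} facet_of ck_polytope m n a b pos"
proof (rule facet_of_hyperplaneI)
  show "convex (ck_polytope m n a b pos)"
    by (simp add: ck_polytope_def)
  show "aff_dim (ck_polytope m n a b pos) = int DIM(real ^ 'k)"
    by (simp add: aff_dim_ck_polytope)
  show "vector_of coef \<bullet> x \<le> bound" if "x \<in> ck_polytope m n a b pos" for x
    using inner_coef_le[OF that] .
  have mem: "selection_vector J y \<in> ck_polytope m n a b pos"
      "vector_of coef \<bullet> selection_vector J y = bound" if "tight J y" for J y
    using that selection_vector_feasible inner_vector_of_selection
    unfolding tight_def ck_polytope_def by (auto intro: hull_inc)
  then show "selection_vector J0 y0 \<in> ck_polytope m n a b pos"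
      "vector_of coef \<bullet> selection_vector J0 y0 = bound"
    using tight_base by blast+
  \<comment> \<open>All coefficients in block \<open>i0\<close> vanish if \<open>a i0 (p i0)\<close>
    is 0, so a nonzero coefficient is taken from another block of \<open>K\<close>, where it is at
    least \<delta>.\<close>
  have "card (K - {i0}) > 0" using i0 finite_K card_K by simp
  then obtain i where i: "i \<in> K" "i \<noteq> i0" by (metis Diff_iff card_gt_0_iff ex_in_conv singletonI)
  have iQ: "i \<in> Q" "i \<in> {1..m}" using i K Q by auto
  have "vector_of coef $ pos (i, p i) = a i (p i) + \<delta>"
    using iQ p[OF iQ(1)] i by (simp add: vector_of_nth coef_def)
  moreover have "a i (p i) + \<delta> > 0"
    using a_nonneg[OF iQ(2) p[OF iQ(1)]] \<delta>_pos by simp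
  ultimately show "vector_of coef \<noteq> 0" by auto
  fix g assume g: "\<And>x. x \<in> ck_polytope m n a b pos \<Longrightarrow> vector_of coef \<bullet> x = bound \<Longrightarrow>
    g \<bullet> x = g \<bullet> selection_vector J0 y0"
  have "selection_sum m (\<lambda>i j. g $ pos (i, j)) J y = g \<bullet> selection_vector J0 y0" if "tight J y" for J y
    using g[OF mem[OF that]] that inner_selection_vector[of J y g] by (simp add: tight_def)
  from proportional_to_coef[OF this]
  obtain \<mu> where \<mu>: "\<And>i j. i \<in> {1..m} \<Longrightarrow> j \<in> {1..n i} \<Longrightarrow> g $ pos (i, j) = \<mu> * coef i j"
    by blast
  have "g $ k = (\<mu> *\<^sub>R vector_of coef) $ k" for k
    by (rule pos_cases[of k]) (simp add: \<mu> vector_of_nth)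
  then show "\<exists>\<mu>. g = \<mu> *\<^sub>R vector_of coef" by (auto simp: vec_eq_iff)
qed

end

section \<open>From the pack to the block parameters\<close>

theorem theorem6:
  fixes m :: nat and n :: "nat \<Rightarrow> nat" and a :: "nat \<Rightarrow> nat \<Rightarrow> real" and b :: real
    and pos :: "nat \<times> nat \<Rightarrow> 'k::finite"
    and P :: "(nat \<times> nat) set" and s :: real and i0 j0 :: nat
    and M0 MP :: "nat set" and lhs :: "real ^ 'k \<Rightarrow> real" and rhs :: real
  assumes pos: "bij_betw pos (index_set m n) UNIV"
    and n_pos: "\<forall>i\<in>{1..m}. n i \<ge> 1"
    and M0: "M0 = singleton_blocks m n"
    and not_all_singleton: "{1..m} \<noteq> M0"
    and nontrivial: "(\<Sum>i\<in>{1..m}. Max (a i ` {1..n i})) > b"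
    and b_pos: "b > 0"
    and a_nonneg: "\<forall>(i, j)\<in>index_set m n. a i j \<ge> 0"
    and a_sorted: "\<forall>i\<in>{1..m} - M0. \<forall>j\<in>{1..<n i}. a i j \<ge> a i (j + 1)"
    and P: "pack m n a b P"
    and MP: "MP = touched_blocks m n P"
    and card: "card (MP - M0) \<ge> 2"
    and s: "s = weight a P"
    and P_mem: "(i0, j0) \<in> P" "i0 \<notin> M0" "j0 = n i0"
    and lhs: "lhs = (\<lambda>x.
        (\<Sum>i\<in>MP - {i0}. \<Sum>j\<in>{1..n i}. a i j * x $ pos (i, j))
      + (\<Sum>(i, j)\<in>{(i, j). (i, j) \<in> P \<and> i \<in> (MP - M0) - {i0}}. (b - s) * x $ pos (i, j))
      + a i0 j0 * x $ pos (i0, j0)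
      + (\<Sum>j\<in>{1..n i0} - {j0}.
           a i0 j0 * max 1 (a i0 j / (a i0 j0 + b - s)) * x $ pos (i0, j)))"
    and rhs: "rhs = b + (real (card (MP - M0)) - 2) * (b - s)"
  shows "valid_inequality lhs rhs (ck_polytope m n a b pos) \<and>
    (maximal_switching_pack m n a b P \<longrightarrow> nondegenerate_lifting m n a P i0 j0 \<longrightarrow>
       facet_defining lhs rhs (ck_polytope m n a b pos))"
proof -
  define K where "K = MP - M0"
  have P_sub: "P \<subseteq> index_set m n" and inj: "inj_on fst P" and s_less: "s < b"
    using P s by (auto simp: pack_def)
  have "\<forall>i\<in>MP. \<exists>j. (i, j) \<in> P"
    using MP by (auto simp: touched_blocks_def)
  \<comment> \<open>The first components of the pack are distinct, so \<open>p\<close> describes the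
    pack completely.\<close>
  then obtain p where p_mem: "\<And>i. i \<in> MP \<Longrightarrow> (i, p i) \<in> P" by metis
  have p_unique: "j = p i" if "(i, j) \<in> P" "i \<in> MP" for i j
    using inj_onD[OF inj _ that(1) p_mem[OF that(2)]] by simp
  have p_range: "p i \<in> {1..n i}" if "i \<in> MP" for i
    using p_mem[OF that] P_sub by (auto simp: index_set_def)
  have in_MP: "i \<in> MP" if "(i, j) \<in> P" for i j
    using that P_sub MP by (auto simp: touched_blocks_def index_set_def)
  have P_eq: "P = (\<lambda>i. (i, p i)) ` MP"
    using p_mem p_unique in_MP by (auto simp: image_iff)
  have i0: "i0 \<in> MP" "i0 \<in> K" and j0: "p i0 = n i0" "p i0 = j0"
    using in_MP[OF P_mem(1)] p_unique[OF P_mem(1)] P_mem(2,3) by (auto simp: K_def)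
  have MP_m: "MP \<subseteq> {1..m}" using MP by (auto simp: touched_blocks_def)
  have antimono: "a i j' \<le> a i j"
    if "i \<in> MP - M0" "1 \<le> j" "j \<le> j'" "j' \<le> n i" for i j j'
    using that(3,2,4)
  proof (induction rule: dec_induct)
    case (step l)
    then have "a i (l + 1) \<le> a i l"
      using a_sorted that(1) MP_m by auto
    then show ?case using step by auto
  qed simp
  interpret pack_inequality m n a b pos MP K p i0 s
  proof
    show "i \<in> MP - K \<Longrightarrow> n i = 1" for i
      using M0 by (auto simp: K_def singleton_blocks_def)
    \<comment> \<open>The pack index of \<open>i0\<close> is the last one, hence of least weight in
      its sorted block.\<close>
    show "j \<in> {1..n i0} \<Longrightarrow> a i0 (p i0) \<le> a i0 j" for j
      using antimono[of i0 j "n i0"] i0 j0 by (auto simp: K_def)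
    have "s = (\<Sum>q\<in>(\<lambda>i. (i, p i)) ` MP. case q of (i, j) \<Rightarrow> a i j)"
      using s P_eq by (simp add: weight_def)
    also have "\<dots> = (\<Sum>i\<in>MP. a i (p i))"
      by (subst sum.reindex) (auto simp: inj_on_def)
    finally show "s = (\<Sum>i\<in>MP. a i (p i))" .
  qed (use pos n_pos b_pos a_nonneg card s_less MP_m i0 p_range in
      \<open>auto simp: K_def index_set_def\<close>)
  have "{(i, j). (i, j) \<in> P \<and> i \<in> (MP - M0) - {i0}} = (\<lambda>i. (i, p i)) ` (K - {i0})"
    using P_eq by (auto simp: K_def)
  then have "(\<Sum>(i, j)\<in>{(i, j). (i, j) \<in> P \<and> i \<in> (MP - M0) - {i0}}. (b - s) * x $ pos (i, j)) =
      (\<Sum>i\<in>K - {i0}. \<delta> * x $ pos (i, p i))" for x :: "real ^ 'k"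
    by (simp add: sum.reindex inj_on_def \<delta>_def)
  then have lhs_eq: "lhs x = vector_of coef \<bullet> x" for x
    unfolding inner_coef lhs j0(2)[symmetric] by (simp add: \<delta>_def add_diff_eq)
  have rhs_eq: "rhs = bound"
    by (simp only: rhs bound_def \<delta>_def K_def[symmetric])
  have valid: "valid_inequality lhs rhs (ck_polytope m n a b pos)"
    unfolding valid_inequality_def lhs_eq rhs_eq using inner_coef_le by blast
  moreover have "facet_defining lhs rhs (ck_polytope m n a b pos)"
    if sw: "maximal_switching_pack m n a b P" and nd: "nondegenerate_lifting m n a P i0 j0"
  proof -
    have p_last: "p i = n i" if "i \<in> MP" for i
      using sw p_mem[OF that] by (auto simp: maximal_switching_pack_def)
    \<comment> \<open>Thus the truncated difference \<open>n i - 1\<close> is a genuine index of the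
      block, and 1 differs from the last index.\<close>
    have n2: "n i \<ge> 2" if "i \<in> K" for i
      using that n_pos M0 MP_m by (force simp: K_def singleton_blocks_def)
    interpret switching_pack_inequality m n a b pos MP K p i0 s
    proof
      fix i assume i: "i \<in> K"
      then have iMP: "i \<in> MP" by (simp add: K_def)
      have "weight a P - a i (n i) + a i (n i - 1) > b"
        using sw i unfolding maximal_switching_pack_def K_def MP M0 by blast
      then have "a i (p i) + \<delta> < a i (n i - 1)"
        using \<delta>_def s p_last[OF iMP] by simp
      \<comment> \<open>Every index other than the last is at most \<open>n i - 1\<close>, so by
        sortedness it weighs at least as much.\<close>
      moreover have "a i (n i - 1) \<le> a i j" if "j \<in> {1..n i}" "j \<noteq> p i" for j
        using antimono[of i j "n i - 1"] that i p_last[OF iMP] by (auto simp: K_def)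
      ultimately show "a i (p i) + \<delta> < a i j" if "j \<in> {1..n i}" "j \<noteq> p i" for j
        using that by fastforce
      show "\<exists>j\<in>{1..n i}. j \<noteq> p i"
        using n2[OF i] p_last[OF iMP] by (intro bexI[of _ 1]) auto
    next
      have "\<exists>l\<in>MP - K. a l (p l) > 0" if "(i, j) \<in> P" "i \<in> singleton_blocks m n" "a i j > 0" for i j
        using that in_MP[OF that(1)] p_unique[OF that(1)] M0 by (auto simp: K_def)
      then show "a i0 (p i0) > 0 \<or> card K = 2 \<or> (\<exists>l\<in>MP - K. a l (p l) > 0)"
        using nd unfolding nondegenerate_lifting_def MP[symmetric] M0[symmetric] K_def[symmetric] j0(2)
        by blast
    qed
    show ?thesis
      using valid facet_of_ck_polytope by (simp add: facet_defining_def lhs_eq rhs_eq)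
  qed
  ultimately show ?thesis by blast
qed

end
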